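(* Let $G$ and $H$ be finite connected graphs. Then $\mathrm{rc}(G\boxtimes H)=\max\{\mathrm{rc}(G),\mathrm{rc}(H)\}$.
   Context: The strong product $G\boxtimes H$ has vertex set $V(G)\times V(H)$, with distinct $(g_1,h_1)$ and $(g_2,h_2)$ adjacent iff ($g_1g_2\in E(G)$ or $g_1=g_2$) and ($h_1h_2\in E(H)$ or $h_1=h_2$). Cop and robber game with radius of capture $k$: first the cop chooses a vertex, then the robber; afterwards, starting with the cop, the players alternately either move to an adjacent vertex or stay put, both knowing both positions. The cop wins if at some point the distance between the players is at most $k$. $\mathcal{CWRC}(k)$ is the class of graphs on which the cop has a winning strategy. $\mathrm{rc}(G)=\min\{k\in\mathbb{N}_0 \mid G\in\mathcal{CWRC}(k)\}$. *)

theory Defs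
  imports "Graph_Theory.Graph_Theory"
begin

text \<open>
  A finite simple graph is a \<^locale>\<open>pair_graph\<close>: a finite, loop-free, symmetric set of arcs
  without parallel arcs, an edge \<open>uv\<close> being the pair of arcs \<open>(u, v)\<close> and \<open>(v, u)\<close>.
\<close>

definition strong_product ::
    "'a pair_pre_digraph \<Rightarrow> 'b pair_pre_digraph \<Rightarrow> ('a \<times> 'b) pair_pre_digraph"
    (infixr "\<boxtimes>" 75) where
  "G \<boxtimes> H = \<lparr> pverts = pverts G \<times> pverts H,
     parcs = {((g1, h1), (g2, h2)) | g1 h1 g2 h2.
       (g1, h1) \<in> pverts G \<times> pverts H \<and> (g2, h2) \<in> pverts G \<times> pverts H \<and>
       (g1, h1) \<noteq> (g2, h2) \<and>
       ((g1, g2) \<in> parcs G \<or> g1 = g2) \<and> ((h1, h2) \<in> parcs H \<or> h1 = h2)} \<rparr>"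

text \<open>
  The library's shortest-path distance with unit weights, i.e. the minimal number of edges of a
  walk; it is infinite between different components.
\<close>

definition gdist :: "'a pair_pre_digraph \<Rightarrow> 'a \<Rightarrow> 'a \<Rightarrow> ereal" where
  "gdist G u v = wf_digraph.\<mu> (with_proj G) (\<lambda>_. 1) u v"

definition legal_move :: "'a pair_pre_digraph \<Rightarrow> 'a \<Rightarrow> 'a \<Rightarrow> bool" where
  "legal_move G u v \<longleftrightarrow> u \<in> pverts G \<and> v \<in> pverts G \<and> (u = v \<or> (u, v) \<in> parcs G)"

definition legal_play :: "'a pair_pre_digraph \<Rightarrow> (nat \<Rightarrow> 'a) \<Rightarrow> bool" where
  "legal_play G p \<longleftrightarrow> p 0 \<in> pverts G \<and> (\<forall>n. legal_move G (p n) (p (Suc n)))"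

text \<open>
  A strategy maps the list of the robber's positions so far, oldest first, to the cop's next
  position; the cop's own earlier positions are determined by it and need not be recorded.  The value
  at the empty list is the cop's starting vertex.  If the robber visits \<open>r 0, r 1, \<dots>\<close>, the
  positions occur in the order \<open>c 0, r 0, c 1, r 1, \<dots>\<close> with \<open>c n = cop_play \<sigma> r n\<close>,
  where \<open>c n\<close> depends on \<open>r 0, \<dots>, r (n - 1)\<close> only.
\<close>

type_synonym 'a cop_strategy = "'a list \<Rightarrow> 'a"

definition cop_play :: "'a cop_strategy \<Rightarrow> (nat \<Rightarrow> 'a) \<Rightarrow> nat \<Rightarrow> 'a" where
  "cop_play \<sigma> r n = \<sigma> (map r [0..<n])"

text \<open>
  Since the cop's strategy is fixed and deterministic, quantifying over all legal robber plays
  \<open>r\<close> covers every robber who reacts to the cop's positions.  The disjunction ranges over all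
  moments of the game: after the robber's choice or move, and after the cop's move.  Play is
  formally continued after a capture, which does not affect who wins.
\<close>

definition winning_cop_strategy ::
    "'a pair_pre_digraph \<Rightarrow> nat \<Rightarrow> 'a cop_strategy \<Rightarrow> bool" where
  "winning_cop_strategy G k \<sigma> \<longleftrightarrow>
     (\<forall>r. legal_play G r \<longrightarrow>
        legal_play G (cop_play \<sigma> r) \<and>
        (\<exists>n. gdist G (cop_play \<sigma> r n) (r n) \<le> ereal (real k) \<or>
             gdist G (cop_play \<sigma> r (Suc n)) (r n) \<le> ereal (real k)))"

definition CWRC :: "nat \<Rightarrow> 'a pair_pre_digraph set" where
  "CWRC k = {G. pair_graph G \<and> (\<exists>\<sigma>. winning_cop_strategy G k \<sigma>)}"

definition rc :: "'a pair_pre_digraph \<Rightarrow> nat" where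
  "rc G = (LEAST k. G \<in> CWRC k)"

lemma pair_graph_strong_product:
  assumes "pair_graph G" "pair_graph H"
  shows "pair_graph (G \<boxtimes> H)"
proof -
  interpret G: pair_graph G by fact
  interpret H: pair_graph H by fact
  have fin: "finite (pverts (G \<boxtimes> H))"
    by (simp add: strong_product_def G.pair_finite_verts H.pair_finite_verts)
  have "parcs (G \<boxtimes> H) \<subseteq> pverts (G \<boxtimes> H) \<times> pverts (G \<boxtimes> H)"
    by (auto simp: strong_product_def)
  then have fin': "finite (parcs (G \<boxtimes> H))"
    using fin finite_subset by blast
  have "sym (parcs (G \<boxtimes> H))"
    using G.sym_arcs H.sym_arcs
    by (auto simp: strong_product_def symmetric_def sym_def)
  then show ?thesis
    using fin fin' by unfold_locales (auto simp: strong_product_def symmetric_def)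
qed

lemma gdist_le_iff:
  assumes "pair_graph G"
  shows "gdist G u v \<le> ereal (real k) \<longleftrightarrow>
    (\<exists>p. pre_digraph.awalk (with_proj G) u p v \<and> length p \<le> k)"
proof -
  interpret pair_graph G by fact
  have cost: "awalk_cost (\<lambda>_. 1) p = real (length p)" for p
    by (induct p) auto
  have mu: "gdist G u v = (INF p\<in>{p. awalk u p v}. ereal (real (length p)))"
    by (simp add: gdist_def \<mu>_def cost)
  show ?thesis
  proof
    assume "gdist G u v \<le> ereal (real k)"
    then have "(INF p\<in>{p. awalk u p v}. ereal (real (length p))) < ereal (real (Suc k))"
      by (simp add: mu le_less_trans)
    then obtain p where "awalk u p v" "ereal (real (length p)) < ereal (real (Suc k))"
      by (auto simp: INF_less_iff)
    then show "\<exists>p. awalk u p v \<and> length p \<le> k"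
      by auto
  next
    assume "\<exists>p. awalk u p v \<and> length p \<le> k"
    then show "gdist G u v \<le> ereal (real k)"
      unfolding mu by (auto intro: INF_lower2)
  qed
qed

text \<open>Every finite connected graph lies in some class, so \<^const>\<open>rc\<close> is a genuine minimum.\<close>

lemma connected_in_CWRC:
  assumes "pair_graph G" "Digraph_Component.connected (with_proj G)"
  shows "\<exists>k. G \<in> CWRC k"
proof -
  interpret pair_graph G by fact
  from assms(2) obtain c where c: "c \<in> pverts G"
    by (auto simp: Digraph_Component.connected_def strongly_connected_def mk_symmetric_def)
  have "strongly_connected G"
    using symmetric_connected_imp_strongly_connected[OF sym_arcs assms(2)] .
  then have "\<forall>v\<in>pverts G. \<exists>p. awalk c p v"
    using c by (auto simp: strongly_connected_def reachable_awalk)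
  then obtain w where w: "\<forall>v\<in>pverts G. awalk c (w v) v" by metis
  define k where "k = Max (length ` w ` pverts G)"
  have le: "length (w v) \<le> k" if "v \<in> pverts G" for v
    unfolding k_def using that by (auto simp: pair_finite_verts intro!: Max_ge)
  have "winning_cop_strategy G k (\<lambda>_. c)"
    unfolding winning_cop_strategy_def
  proof (intro allI impI conjI)
    fix r assume r: "legal_play G r"
    show "legal_play G (cop_play (\<lambda>_. c) r)"
      using c by (auto simp: legal_play_def legal_move_def cop_play_def)
    have "gdist G c (r 0) \<le> ereal (real k)"
      using r w le by (auto simp: gdist_le_iff[OF assms(1)] legal_play_def)
    then show "\<exists>n. gdist G (cop_play (\<lambda>_. c) r n) (r n) \<le> ereal (real k) \<or>
        gdist G (cop_play (\<lambda>_. c) r (Suc n)) (r n) \<le> ereal (real k)"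
      by (auto simp: cop_play_def)
  qed
  then show ?thesis using assms(1) by (auto simp: CWRC_def)
qed

end

theory Submission
  imports Defs
begin

text \<open>
  Distances in \<open>G \<boxtimes> H\<close> are maxima of the coordinate distances and moves in \<open>G \<boxtimes> H\<close> are pairs of
  moves. For the upper bound the cop plays winning strategies in both coordinates at once; these
  succeed simultaneously because a cop who has once come within distance \<open>k\<close> can
  restore this distance after every later move of the robber by a step along a shortest
  path. For the lower bound, each factor is a retract of the product, and a winning
  strategy passes to retracts.
\<close>

section \<open>Distance bounds as counts of legal moves\<close>

lemma legal_move_refl [simp]: "legal_move G v v \<longleftrightarrow> v \<in> pverts G"
  by (simp add: legal_move_def)

lemma legal_play_in_verts: "legal_play G p \<Longrightarrow> p n \<in> pverts G"
  by (auto simp: legal_play_def legal_move_def)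

lemma cop_play_0: "cop_play \<sigma> r 0 = \<sigma> []"
  by (simp add: cop_play_def)

text \<open>Only the empty walk has length zero, and it exists at vertices only. The bound keeps the
  form \<open>ereal (real 0)\<close> to match the base case of inductions on the bound.\<close>

lemma gdist_le_0_iff:
  assumes "pair_graph G"
  shows "gdist G u v \<le> ereal (real 0) \<longleftrightarrow> u = v \<and> u \<in> pverts G"
proof -
  interpret pair_graph G by fact
  show ?thesis
    by (simp only: gdist_le_iff[OF assms]) (auto simp: awalk_Nil_iff)
qed

text \<open>Split off the first arc of a walk; the empty walk is covered because a legal move may
  stay put. Later distance estimates thus become inductions on the bound that never mention
  walks.\<close>

lemma gdist_le_Suc_iff:
  assumes "pair_graph G"
  shows "gdist G u v \<le> ereal (real (Suc k)) \<longleftrightarrow>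
    (\<exists>w. legal_move G u w \<and> gdist G w v \<le> ereal (real k))"
proof -
  interpret pair_graph G by fact
  show ?thesis
    unfolding gdist_le_iff[OF assms]
  proof
    assume "\<exists>p. awalk u p v \<and> length p \<le> Suc k"
    then obtain p where p: "awalk u p v" "length p \<le> Suc k" by blast
    show "\<exists>w. legal_move G u w \<and> (\<exists>p. awalk w p v \<and> length p \<le> k)"
    proof (cases p)
      case Nil
      with p(1) have "legal_move G u u" "awalk u [] v"
        by (auto simp: awalk_Nil_iff)
      then show ?thesis using list.size(3) by (metis le0)
    next
      case (Cons e q)
      with p have e: "e \<in> parcs G" "u = fst e" "awalk (snd e) q v" "length q \<le> k"
        by (auto simp: awalk_Cons_iff)
      then have "legal_move G u (snd e)"
        using in_arcsD1 in_arcsD2 by (cases e) (auto simp: legal_move_def)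
      with e show ?thesis by blast
    qed
  next
    assume "\<exists>w. legal_move G u w \<and> (\<exists>p. awalk w p v \<and> length p \<le> k)"
    then obtain w p where w: "legal_move G u w" "awalk w p v" "length p \<le> k" by blast
    show "\<exists>p. awalk u p v \<and> length p \<le> Suc k"
    proof (cases "u = w")
      case True
      with w show ?thesis using le_SucI by blast
    next
      case False
      with w have "awalk u ((u, w) # p) v"
        by (auto simp: awalk_Cons_iff legal_move_def)
      with w(3) show ?thesis by (metis Suc_le_mono length_Cons)
    qed
  qed
qed

lemma gdist_le_mono:
  "gdist G u v \<le> ereal (real k) \<Longrightarrow> k \<le> l \<Longrightarrow> gdist G u v \<le> ereal (real l)"
  by (erule order_trans) simp

text \<open>Triangle inequality for one robber move. The induction peels moves off at
  \<open>u\<close>, the end opposite to the one that moves.\<close>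

lemma gdist_le_Suc_step:
  assumes "pair_graph G" "gdist G u v \<le> ereal (real k)" "legal_move G v w"
  shows "gdist G u w \<le> ereal (real (Suc k))"
  using assms(2)
proof (induction k arbitrary: u)
  case 0
  then have "u = v" by (simp only: gdist_le_0_iff[OF assms(1)])
  moreover have "gdist G w w \<le> ereal (real 0)"
    using assms(3) by (simp only: gdist_le_0_iff[OF assms(1)] legal_move_def)
  ultimately show ?case
    using assms(3) gdist_le_Suc_iff[OF assms(1)] by blast
next
  case (Suc k)
  then show ?case
    using gdist_le_Suc_iff[OF assms(1)] by blast
qed

text \<open>The map \<open>f\<close> may collapse edges, but a sequence of moves is carried to a
  sequence of equally many moves.\<close>

lemma gdist_le_image:
  assumes "pair_graph G" "pair_graph H"
    and hom: "\<And>u v. legal_move G u v \<Longrightarrow> legal_move H (f u) (f v)"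
    and "gdist G u v \<le> ereal (real k)"
  shows "gdist H (f u) (f v) \<le> ereal (real k)"
  using assms(4)
proof (induction k arbitrary: u)
  case 0
  then have "u = v" "u \<in> pverts G" using gdist_le_0_iff[OF assms(1)] by blast+
  \<comment> \<open>Staying put at \<open>u\<close> is a legal move, so \<open>hom\<close> also
    makes \<open>f\<close> send vertices to vertices.\<close>
  then have "f u \<in> pverts H" using hom[of u u] by simp
  with \<open>u = v\<close> show ?case by (simp only: gdist_le_0_iff[OF assms(2)])
next
  case (Suc k)
  then show ?case
    using gdist_le_Suc_iff[OF assms(1)] gdist_le_Suc_iff[OF assms(2)] hom by blast
qed

section \<open>Moves and distances in strong products\<close>

lemma pverts_strong_product [simp]: "pverts (G \<boxtimes> H) = pverts G \<times> pverts H"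
  by (simp add: strong_product_def)

lemma legal_move_strong_product:
  "legal_move (G \<boxtimes> H) u v \<longleftrightarrow> legal_move G (fst u) (fst v) \<and> legal_move H (snd u) (snd v)"
  by (cases u; cases v) (auto simp: legal_move_def strong_product_def)

lemma legal_play_strong_product:
  "legal_play (G \<boxtimes> H) p \<longleftrightarrow> legal_play G (fst \<circ> p) \<and> legal_play H (snd \<circ> p)"
  by (auto simp: legal_play_def legal_move_strong_product mem_Times_iff)

text \<open>Both coordinates advance along their walks at the same time, and the one that arrives
  first waits.\<close>

lemma gdist_strong_product_le:
  assumes "pair_graph G" "pair_graph H"
    and "gdist G a c \<le> ereal (real k)" "gdist H b d \<le> ereal (real k)"
  shows "gdist (G \<boxtimes> H) (a, b) (c, d) \<le> ereal (real k)"
  using assms(3,4)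
proof (induction k arbitrary: a b)
  case 0
  then have "(a, b) = (c, d)" "(a, b) \<in> pverts (G \<boxtimes> H)"
    unfolding gdist_le_0_iff[OF assms(1)] gdist_le_0_iff[OF assms(2)] by auto
  then show ?case
    by (simp only: gdist_le_0_iff[OF pair_graph_strong_product[OF assms(1,2)]])
next
  case (Suc k)
  then obtain a' b' where ab: "legal_move G a a'" "gdist G a' c \<le> ereal (real k)"
      "legal_move H b b'" "gdist H b' d \<le> ereal (real k)"
    unfolding gdist_le_Suc_iff[OF assms(1)] gdist_le_Suc_iff[OF assms(2)] by blast
  then have "legal_move (G \<boxtimes> H) (a, b) (a', b')"
    by (simp add: legal_move_strong_product)
  with Suc.IH[OF ab(2,4)] show ?case
    unfolding gdist_le_Suc_iff[OF pair_graph_strong_product[OF assms(1,2)]] by blast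
qed

section \<open>Strategies on retracts\<close>

text \<open>The cop pretends that the robber moves on the image under \<open>g\<close>, answers
  there with \<sigma>, and projects the answer back by \<open>f\<close>.\<close>

lemma CWRC_retract:
  assumes "P \<in> CWRC k" "pair_graph G"
    and f: "\<And>u v. legal_move P u v \<Longrightarrow> legal_move G (f u) (f v)"
    and g: "\<And>u v. legal_move G u v \<Longrightarrow> legal_move P (g u) (g v)"
    and fg: "\<And>v. v \<in> pverts G \<Longrightarrow> f (g v) = v"
  shows "G \<in> CWRC k"
proof -
  from assms(1) obtain \<sigma> where P: "pair_graph P" and \<sigma>: "winning_cop_strategy P k \<sigma>"
    by (auto simp: CWRC_def)
  have f_vert: "f v \<in> pverts G" if "v \<in> pverts P" for v
    using f[of v v] that by simp
  have g_vert: "g v \<in> pverts P" if "v \<in> pverts G" for v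
    using g[of v v] that by simp
  define \<tau> where "\<tau> rs = f (\<sigma> (map g rs))" for rs
  have play: "cop_play \<tau> r n = f (cop_play \<sigma> (g \<circ> r) n)" for r n
    by (simp add: cop_play_def \<tau>_def)
  have "winning_cop_strategy G k \<tau>"
    unfolding winning_cop_strategy_def
  proof (intro allI impI)
    fix r assume r: "legal_play G r"
    then have "legal_play P (g \<circ> r)"
      by (auto simp: legal_play_def g g_vert)
    with \<sigma> obtain n where legal: "legal_play P (cop_play \<sigma> (g \<circ> r))"
      and n: "gdist P (cop_play \<sigma> (g \<circ> r) n) (g (r n)) \<le> ereal (real k) \<or>
             gdist P (cop_play \<sigma> (g \<circ> r) (Suc n)) (g (r n)) \<le> ereal (real k)"
      unfolding winning_cop_strategy_def comp_def by blast
    \<comment> \<open>As \<open>f\<close> does not increase distances, capture of the image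
      \<open>g (r n)\<close> in \<open>P\<close> thereby becomes capture of the real robber.\<close>
    have "f (g (r n)) = r n"
      using r by (simp add: fg legal_play_in_verts)
    with n have "gdist G (cop_play \<tau> r n) (r n) \<le> ereal (real k) \<or>
        gdist G (cop_play \<tau> r (Suc n)) (r n) \<le> ereal (real k)"
      using gdist_le_image[OF P assms(2), of f] f by (metis play)
    moreover have "legal_play G (cop_play \<tau> r)"
      using legal by (auto simp: legal_play_def play f f_vert)
    ultimately show "legal_play G (cop_play \<tau> r) \<and>
        (\<exists>n. gdist G (cop_play \<tau> r n) (r n) \<le> ereal (real k) \<or>
             gdist G (cop_play \<tau> r (Suc n)) (r n) \<le> ereal (real k))"
      by blast
  qed
  with assms(2) show ?thesis by (auto simp: CWRC_def)
qed

section \<open>Persistent pursuit\<close>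

text \<open>The chosen vertex is meaningful only if \<open>c\<close> is within \<open>Suc k\<close>
  of \<open>v\<close>; otherwise it is arbitrary.\<close>

definition pursue :: "'a pair_pre_digraph \<Rightarrow> nat \<Rightarrow> 'a \<Rightarrow> 'a \<Rightarrow> 'a" where
  "pursue G k c v = (SOME w. legal_move G c w \<and> gdist G w v \<le> ereal (real k))"

lemma pursue:
  assumes "pair_graph G" "gdist G c v \<le> ereal (real (Suc k))"
  shows "legal_move G c (pursue G k c v)" "gdist G (pursue G k c v) v \<le> ereal (real k)"
  using someI_ex[OF assms(2)[unfolded gdist_le_Suc_iff[OF assms(1)]]]
  by (simp_all add: pursue_def)

text \<open>The list argument is in reverse order, newest robber position first.\<close>

primrec persistent_rev ::
    "'a pair_pre_digraph \<Rightarrow> nat \<Rightarrow> 'a cop_strategy \<Rightarrow> 'a list \<Rightarrow> 'a" where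
  "persistent_rev G k \<sigma> [] = \<sigma> []"
| "persistent_rev G k \<sigma> (v # vs) =
    (if gdist G (persistent_rev G k \<sigma> vs) v \<le> ereal (real (Suc k))
     then pursue G k (persistent_rev G k \<sigma> vs) v else \<sigma> (rev (v # vs)))"

text \<open>Strategies read histories oldest first, whereas the recursion has to split off the
  newest position; hence the reversal.\<close>

definition persistent :: "'a pair_pre_digraph \<Rightarrow> nat \<Rightarrow> 'a cop_strategy \<Rightarrow> 'a cop_strategy" where
  "persistent G k \<sigma> rs = persistent_rev G k \<sigma> (rev rs)"

lemma cop_play_persistent_Suc:
  "cop_play (persistent G k \<sigma>) r (Suc n) =
    (if gdist G (cop_play (persistent G k \<sigma>) r n) (r n) \<le> ereal (real (Suc k))
     then pursue G k (cop_play (persistent G k \<sigma>) r n) (r n) else cop_play \<sigma> r (Suc n))"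
  by (simp add: cop_play_def persistent_def)

text \<open>A winning strategy guarantees only one moment of capture. Having the bound at all late
  times is what allows captures in two factors to be synchronised.\<close>

lemma persistent_wins:
  assumes "pair_graph G" "winning_cop_strategy G k \<sigma>" "legal_play G r"
  defines "c \<equiv> cop_play (persistent G k \<sigma>) r"
  shows "legal_play G c" "\<exists>N. \<forall>n\<ge>N. gdist G (c (Suc n)) (r n) \<le> ereal (real k)"
proof -
  \<comment> \<open>The robber has just moved and the cop is to move. The threshold is
    \<open>Suc k\<close> because one cop step then brings the distance down to
    \<open>k\<close>.\<close>
  define near where "near n \<longleftrightarrow> gdist G (c n) (r n) \<le> ereal (real (Suc k))" for n
  define s where "s = cop_play \<sigma> r"
  have c_0: "c 0 = s 0"
    by (simp add: c_def s_def cop_play_0 persistent_def)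
  have c_Suc: "c (Suc n) = (if near n then pursue G k (c n) (r n) else s (Suc n))" for n
    unfolding near_def c_def s_def by (rule cop_play_persistent_Suc)
  have close: "legal_move G (c n) (c (Suc n))" "gdist G (c (Suc n)) (r n) \<le> ereal (real k)"
    if "near n" for n
    using pursue[OF assms(1) that[unfolded near_def]] that by (simp_all add: c_Suc)
  \<comment> \<open>The cop's step reaches distance \<open>k\<close>, and the robber's reply adds at
    most one.\<close>
  have near_Suc: "near (Suc n)" if "near n" for n
    using gdist_le_Suc_step[OF assms(1) close(2)[OF that]] assms(3)
    unfolding near_def legal_play_def by blast
  have near_mono: "near n" if "near m" "m \<le> n" for m n
    using that(2,1) by (induction rule: dec_induct) (auto intro: near_Suc)
  \<comment> \<open>Pursuit never ends once begun, so a position that is not near has no near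
    predecessor, and the cop has followed \<sigma> up to then.\<close>
  have far: "c n = s n" if "\<not> near n" for n
    using c_0 c_Suc near_Suc that by (cases n) auto
  have s: "legal_play G s"
    and cap: "\<exists>n. gdist G (s n) (r n) \<le> ereal (real k) \<or> gdist G (s (Suc n)) (r n) \<le> ereal (real k)"
    using assms(2,3) by (auto simp: winning_cop_strategy_def s_def)
  \<comment> \<open>The cop never returns from pursuit to \<sigma>: each move is either a pursuit
    step or a move between consecutive positions of \<sigma>.\<close>
  have "legal_move G (c n) (c (Suc n))" for n
    using close(1) far c_Suc s by (cases "near n") (auto simp: legal_play_def)
  then show "legal_play G c"
    using s by (simp add: legal_play_def c_0)
  \<comment> \<open>Otherwise the cop would follow \<sigma> forever, and the capture achieved by
    \<sigma> would itself produce a near position.\<close>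
  have "\<exists>N. near N"
  proof (rule ccontr)
    assume "\<nexists>N. near N"
    then have never: "\<not> gdist G (s n) (r n) \<le> ereal (real (Suc k))" for n
      using far near_def by metis
    from cap obtain n where "gdist G (s n) (r n) \<le> ereal (real k) \<or>
        gdist G (s (Suc n)) (r n) \<le> ereal (real k)" by blast
    then show False
    proof
      assume "gdist G (s n) (r n) \<le> ereal (real k)"
      then have "gdist G (s n) (r n) \<le> ereal (real (Suc k))"
        by (rule gdist_le_mono) simp
      with never show False by blast
    next
      \<comment> \<open>For a capture by the cop's own move, the distance before that move was at
        most \<open>Suc k\<close>.\<close>
      assume "gdist G (s (Suc n)) (r n) \<le> ereal (real k)"
      with s have "gdist G (s n) (r n) \<le> ereal (real (Suc k))"
        unfolding gdist_le_Suc_iff[OF assms(1)] legal_play_def by blast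
      with never show False by blast
    qed
  qed
  then show "\<exists>N. \<forall>n\<ge>N. gdist G (c (Suc n)) (r n) \<le> ereal (real k)"
    using near_mono close(2) by blast
qed

section \<open>Combining strategies in the product\<close>

lemma CWRC_strong_product:
  assumes "G \<in> CWRC k" "H \<in> CWRC l"
  shows "G \<boxtimes> H \<in> CWRC (max k l)"
proof -
  from assms obtain \<sigma> \<tau> where G: "pair_graph G" "winning_cop_strategy G k \<sigma>"
    and H: "pair_graph H" "winning_cop_strategy H l \<tau>"
    by (auto simp: CWRC_def)
  define \<rho> where
    "\<rho> rs = (persistent G k \<sigma> (map fst rs), persistent H l \<tau> (map snd rs))" for rs
  have play: "cop_play \<rho> r n =
      (cop_play (persistent G k \<sigma>) (fst \<circ> r) n, cop_play (persistent H l \<tau>) (snd \<circ> r) n)" for r n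
    by (simp add: cop_play_def \<rho>_def)
  have "winning_cop_strategy (G \<boxtimes> H) (max k l) \<rho>"
    unfolding winning_cop_strategy_def
  proof (intro allI impI conjI)
    fix r assume "legal_play (G \<boxtimes> H) r"
    then have r: "legal_play G (fst \<circ> r)" "legal_play H (snd \<circ> r)"
      by (simp_all add: legal_play_strong_product)
    note g = persistent_wins[OF G r(1)] and h = persistent_wins[OF H r(2)]
    show "legal_play (G \<boxtimes> H) (cop_play \<rho> r)"
      using g(1) h(1) by (simp add: legal_play_strong_product play comp_def)
    from g(2) obtain M where M: "\<And>n. n \<ge> M \<Longrightarrow>
        gdist G (cop_play (persistent G k \<sigma>) (fst \<circ> r) (Suc n)) ((fst \<circ> r) n) \<le> ereal (real k)"
      by blast
    from h(2) obtain N where N: "\<And>n. n \<ge> N \<Longrightarrow>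
        gdist H (cop_play (persistent H l \<tau>) (snd \<circ> r) (Suc n)) ((snd \<circ> r) n) \<le> ereal (real l)"
      by blast
    \<comment> \<open>From this time on both coordinate bounds hold, so they hold at the same
      moment.\<close>
    define n where "n = max M N"
    have "gdist (G \<boxtimes> H) (cop_play \<rho> r (Suc n)) ((fst \<circ> r) n, (snd \<circ> r) n) \<le> ereal (real (max k l))"
      unfolding play
      by (rule gdist_strong_product_le[OF G(1) H(1) gdist_le_mono[OF M] gdist_le_mono[OF N]])
        (simp_all add: n_def)
    then show "\<exists>n. gdist (G \<boxtimes> H) (cop_play \<rho> r n) (r n) \<le> ereal (real (max k l)) \<or>
        gdist (G \<boxtimes> H) (cop_play \<rho> r (Suc n)) (r n) \<le> ereal (real (max k l))"
      by (auto simp: comp_def)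
  qed
  then show ?thesis
    using pair_graph_strong_product[OF G(1) H(1)] by (auto simp: CWRC_def)
qed

section \<open>Factors as retracts, and the capture radius\<close>

lemma connected_pverts_nonempty:
  "Digraph_Component.connected (with_proj G) \<Longrightarrow> pverts G \<noteq> {}"
  by (simp add: Digraph_Component.connected_def strongly_connected_def mk_symmetric_def)

text \<open>The layer over a fixed vertex \<open>h\<close> is a copy of \<open>G\<close>, and
  \<open>fst\<close> retracts the product onto it.\<close>

lemma CWRC_strong_product_fstD:
  assumes "G \<boxtimes> H \<in> CWRC k" "pair_graph G" "pverts H \<noteq> {}"
  shows "G \<in> CWRC k"
proof -
  from assms(3) obtain h where "h \<in> pverts H" by blast
  then show ?thesis
    by (intro CWRC_retract[OF assms(1,2), where f = fst and g = "\<lambda>v. (v, h)"])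
      (simp_all add: legal_move_strong_product)
qed

lemma CWRC_strong_product_sndD:
  assumes "G \<boxtimes> H \<in> CWRC k" "pair_graph H" "pverts G \<noteq> {}"
  shows "H \<in> CWRC k"
proof -
  from assms(3) obtain g where "g \<in> pverts G" by blast
  then show ?thesis
    by (intro CWRC_retract[OF assms(1,2), where f = snd and g = "\<lambda>v. (g, v)"])
      (simp_all add: legal_move_strong_product)
qed

lemma rc_le: "G \<in> CWRC k \<Longrightarrow> rc G \<le> k"
  unfolding rc_def by (rule Least_le)

text \<open>Membership for some \<open>k\<close> ensures that the \<open>LEAST\<close> in
  \<open>rc\<close> is attained.\<close>

lemma in_CWRC_rc: "G \<in> CWRC k \<Longrightarrow> G \<in> CWRC (rc G)"
  unfolding rc_def by (rule LeastI)

theorem theorem5p10: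
  fixes G :: "'a pair_pre_digraph" and H :: "'b pair_pre_digraph"
  assumes "pair_graph G" and "Digraph_Component.connected (with_proj G)"
    and "pair_graph H" and "Digraph_Component.connected (with_proj H)"
  shows "rc (G \<boxtimes> H) = max (rc G) (rc H)"
proof (rule antisym)
  have "G \<in> CWRC (rc G)" "H \<in> CWRC (rc H)"
    using connected_in_CWRC assms in_CWRC_rc by blast+
  then have upper: "G \<boxtimes> H \<in> CWRC (max (rc G) (rc H))"
    by (rule CWRC_strong_product)
  then show "rc (G \<boxtimes> H) \<le> max (rc G) (rc H)"
    by (rule rc_le)
  \<comment> \<open>The upper bound also supplies the radius which shows that the minimum for the
    product exists.\<close>
  have "G \<boxtimes> H \<in> CWRC (rc (G \<boxtimes> H))"
    using upper by (rule in_CWRC_rc)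
  then have "G \<in> CWRC (rc (G \<boxtimes> H))" "H \<in> CWRC (rc (G \<boxtimes> H))"
    using assms connected_pverts_nonempty CWRC_strong_product_fstD CWRC_strong_product_sndD
    by blast+
  then show "max (rc G) (rc H) \<le> rc (G \<boxtimes> H)"
    by (simp add: rc_le)
qed

end
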